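(* Let $f:\mathbb{R}\to\mathbb{TP}^n$ be a non-constant tropical holomorphic curve and let $P\not\equiv 0_\circ$ be a homogeneous tropical polynomial of degree $d$ in $n+1$ variables with tropical meromorphic coefficients $a_0(x),\dots,a_k(x)$. If $N(r,a_j)=o(T_f(r))$ for all coefficients $a_j$, then $$\psi(P,f)\,T_f(r)\le\frac1d N\big(r,1_\circ\oslash(P\circ f)\big)+o(T_f(r))\le\Psi(P,f)\,T_f(r)$$ as $r\to\infty$ (without exceptional set).
   Context: $0_\circ=-\infty$, $1_\circ=0$, $a\oslash b=a-b$, so $1_\circ\oslash g=-g$. A tropical meromorphic function is a continuous piecewise linear $g:\mathbb{R}\to\mathbb{R}$ (finitely many affine pieces on each bounded interval); with $\omega_g(x)=\lim_{\varepsilon\to0^+}(g'(x+\varepsilon)-g'(x-\varepsilon))$, $x$ is a root if $\omega_g(x)>0$, a pole if $\omega_g(x)<0$, of multiplicity $\tau_g(x)=|\omega_g(x)|$. It is tropical entire if it has no poles. $N(r,g)=\frac12\sum_{|b|<r}\tau_g(b)(r-|b|)$ over the poles $b$ of $g$ in $(-r,r)$. $\mathbb{TP}^n$ is the quotient of $(\mathbb{R}\cup\{-\infty\})^{n+1}\setminus\{(-\infty,\dots,-\infty)\}$ by adding a common real constant to all coordinates. A tropical holomorphic curve is $f=[f_0:\cdots:f_n]:\mathbb{R}\to\mathbb{TP}^n$ with $f_0,\dots,f_n$ tropical entire functions having no root common to all of them; $(f_0,\dots,f_n)$ is a (fixed) reduced representation. Put $\|f(x)\|=\max_i f_i(x)$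 and $T_f(r)=\frac12(\|f(r)\|+\|f(-r)\|)$ (Cartan characteristic). A homogeneous tropical polynomial of degree $d>0$ with tropical meromorphic coefficients is $P(x,x_0,\dots,x_n)=\max_{\alpha}\{a_\alpha(x)+\alpha_0x_0+\cdots+\alpha_nx_n\}$, the maximum over finitely many $\alpha\in\mathbb{R}_{\ge0}^{n+1}$ with $\alpha_0+\cdots+\alpha_n=d$, the $a_\alpha$ being tropical meromorphic (terms with coefficient $0_\circ$ are omitted; $P\not\equiv0_\circ$ means at least one term occurs). Write $P\circ f$ or $P(f)$ for $P(f)(x)=\max_\alpha\{a_\alpha(x)+\alpha_0f_0(x)+\cdots+\alpha_nf_n(x)\}$. Define $$\psi(P,f)=\liminf_{r\to\infty}\frac{\frac12(P(f)(r)+P(f)(-r))}{d\,T_f(r)},\qquad \Psi(P,f)=\limsup_{r\to\infty}\frac{\frac12(P(f)(r)+P(f)(-r))}{d\,T_f(r)}$$ (extended real values). The displayed chain of inequalities means that each inequality holds up to an additive $o(T_f(r))$ term, i.e. $\liminf_{r\to\infty}\frac{N(r,1_\circ\oslash(P\circ f))}{d\,T_f(r)}\ge\psi(P,f)$ and $\limsup_{r\to\infty}\frac{N(r,1_\circ\oslash(P\circ f))}{d\,T_f(r)}\le\Psi(P,f)$. *)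

theory Defs
  imports "HOL-Analysis.Analysis" "HOL-Library.Landau_Symbols"
begin

text \<open>Tropical meromorphic functions are real-valued here: the function identically \<open>-\<infinity>\<close>
  is not one of them. Since \<open>1\<^sub>\<circ> = 0\<close> and tropical division is subtraction, the tropical
  reciprocal of \<open>g\<close> is \<open>\<lambda>x. - g x\<close>.\<close>

definition tropical_meromorphic :: "(real \<Rightarrow> real) \<Rightarrow> bool" where
  "tropical_meromorphic g \<longleftrightarrow>
     continuous_on UNIV g \<and>
     (\<forall>a b. \<exists>\<J>. finite \<J> \<and> {a..b} \<subseteq> \<Union>\<J> \<and>
        (\<forall>J\<in>\<J>. is_interval J \<and> (\<exists>m c. \<forall>x\<in>J. g x = m * x + c)))"

definition slope_jump :: "(real \<Rightarrow> real) \<Rightarrow> real \<Rightarrow> real" where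
  "slope_jump g x = Lim (at_right 0) (\<lambda>\<epsilon>. deriv g (x + \<epsilon>) - deriv g (x - \<epsilon>))"

definition tropical_root :: "(real \<Rightarrow> real) \<Rightarrow> real \<Rightarrow> bool" where
  "tropical_root g x \<longleftrightarrow> slope_jump g x > 0"

definition tropical_pole :: "(real \<Rightarrow> real) \<Rightarrow> real \<Rightarrow> bool" where
  "tropical_pole g x \<longleftrightarrow> slope_jump g x < 0"

definition tropical_multiplicity :: "(real \<Rightarrow> real) \<Rightarrow> real \<Rightarrow> real" where
  "tropical_multiplicity g x = \<bar>slope_jump g x\<bar>"

definition tropical_entire :: "(real \<Rightarrow> real) \<Rightarrow> bool" where
  "tropical_entire g \<longleftrightarrow> tropical_meromorphic g \<and> (\<forall>x. \<not> tropical_pole g x)"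

definition pole_counting :: "real \<Rightarrow> (real \<Rightarrow> real) \<Rightarrow> real" where
  "pole_counting r g =
     (1/2) * (\<Sum>b | tropical_pole g b \<and> \<bar>b\<bar> < r. tropical_multiplicity g b * (r - \<bar>b\<bar>))"

text \<open>Homogeneous coordinates of \<open>TP\<^sup>n\<close> are indexed by a finite type with \<open>n + 1\<close> elements.
  The relation is a partial equivalence: its domain consists of the vectors with entries in
  \<open>\<real> \<union> {-\<infinity>}\<close>, not all of them \<open>-\<infinity>\<close>.\<close>

definition tropical_coords :: "('n \<Rightarrow> ereal) set" where
  "tropical_coords = {u. (\<forall>i. u i \<noteq> \<infinity>) \<and> (\<exists>i. u i \<noteq> -\<infinity>)}"

definition tropical_proj_rel :: "('n \<Rightarrow> ereal) \<Rightarrow> ('n \<Rightarrow> ereal) \<Rightarrow> bool" where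
  "tropical_proj_rel u v \<longleftrightarrow>
     u \<in> tropical_coords \<and> v \<in> tropical_coords \<and> (\<exists>c::real. \<forall>i. v i = u i + ereal c)"

lemma part_equivp_tropical_proj_rel: "part_equivp (tropical_proj_rel :: ('n \<Rightarrow> ereal) \<Rightarrow> _)"
proof (rule part_equivpI)
  have "tropical_proj_rel (\<lambda>_::'n. 0) (\<lambda>_. 0)"
    unfolding tropical_proj_rel_def tropical_coords_def by (auto intro: exI[of _ "0::real"])
  then show "\<exists>u::'n \<Rightarrow> ereal. tropical_proj_rel u u" by blast
  show "symp (tropical_proj_rel :: ('n \<Rightarrow> ereal) \<Rightarrow> _)"
  proof (rule sympI)
    fix u v :: "'n \<Rightarrow> ereal" assume uv: "tropical_proj_rel u v"
    then obtain c :: real where c: "\<And>i. v i = u i + ereal c"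
      by (auto simp: tropical_proj_rel_def)
    have "u i = v i + ereal (- c)" for i
      by (cases "u i") (auto simp: c)
    with uv show "tropical_proj_rel v u" by (auto simp: tropical_proj_rel_def)
  qed
  show "transp (tropical_proj_rel :: ('n \<Rightarrow> ereal) \<Rightarrow> _)"
  proof (rule transpI)
    fix u v w :: "'n \<Rightarrow> ereal"
    assume uv: "tropical_proj_rel u v" and vw: "tropical_proj_rel v w"
    from uv obtain c :: real where c: "\<And>i. v i = u i + ereal c"
      by (auto simp: tropical_proj_rel_def)
    from vw obtain c' :: real where c': "\<And>i. w i = v i + ereal c'"
      by (auto simp: tropical_proj_rel_def)
    have "w i = u i + ereal (c + c')" for i
      by (cases "u i") (auto simp: c c')
    with uv vw show "tropical_proj_rel u w" by (auto simp: tropical_proj_rel_def)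
  qed
qed

quotient_type 'n tropical_proj = "'n \<Rightarrow> ereal" / partial: tropical_proj_rel
  by (rule part_equivp_tropical_proj_rel)

text \<open>A curve \<open>f\<close> is tropical holomorphic iff it has some reduced representation \<open>F\<close>.\<close>

definition reduced_representation ::
    "(real \<Rightarrow> 'n::finite tropical_proj) \<Rightarrow> ('n \<Rightarrow> real \<Rightarrow> real) \<Rightarrow> bool" where
  "reduced_representation f F \<longleftrightarrow>
     (\<forall>i. tropical_entire (F i)) \<and>
     (\<nexists>x. \<forall>i. tropical_root (F i) x) \<and>
     (\<forall>x. f x = abs_tropical_proj (\<lambda>i. ereal (F i x)))"

definition curve_norm :: "('n::finite \<Rightarrow> real \<Rightarrow> real) \<Rightarrow> real \<Rightarrow> real" where
  "curve_norm F x = (MAX i. F i x)"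

definition cartan_char :: "('n::finite \<Rightarrow> real \<Rightarrow> real) \<Rightarrow> real \<Rightarrow> real" where
  "cartan_char F r = (1/2) * (curve_norm F r + curve_norm F (- r))"

text \<open>A tropical polynomial maps the exponent \<open>\<alpha>\<close> of each occurring term to its coefficient
  \<open>a\<^sub>\<alpha>\<close> and all other exponents to \<^const>\<open>None\<close>. Hence \<^const>\<open>Map.empty\<close> is the
  polynomial \<open>0\<^sub>\<circ>\<close>; its evaluation below is unspecified. Exponents, and so the degree, are
  real.\<close>

type_synonym 'n tropical_poly = "('n \<Rightarrow> real) \<rightharpoonup> (real \<Rightarrow> real)"

definition homogeneous_tropical_poly :: "real \<Rightarrow> 'n::finite tropical_poly \<Rightarrow> bool" where
  "homogeneous_tropical_poly d P \<longleftrightarrow>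
     d > 0 \<and> finite (dom P) \<and>
     (\<forall>\<alpha>\<in>dom P. (\<forall>i. \<alpha> i \<ge> 0) \<and> (\<Sum>i\<in>UNIV. \<alpha> i) = d) \<and>
     (\<forall>a\<in>ran P. tropical_meromorphic a)"

definition poly_comp ::
    "'n::finite tropical_poly \<Rightarrow> ('n \<Rightarrow> real \<Rightarrow> real) \<Rightarrow> real \<Rightarrow> real" where
  "poly_comp P F x = (MAX \<alpha>\<in>dom P. the (P \<alpha>) x + (\<Sum>i\<in>UNIV. \<alpha> i * F i x))"

definition lower_psi ::
    "real \<Rightarrow> 'n::finite tropical_poly \<Rightarrow> ('n \<Rightarrow> real \<Rightarrow> real) \<Rightarrow> ereal" where
  "lower_psi d P F =
     Liminf at_top (\<lambda>r. ereal ((1/2) * (poly_comp P F r + poly_comp P F (- r))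
                                / (d * cartan_char F r)))"

definition upper_psi ::
    "real \<Rightarrow> 'n::finite tropical_poly \<Rightarrow> ('n \<Rightarrow> real \<Rightarrow> real) \<Rightarrow> ereal" where
  "upper_psi d P F =
     Limsup at_top (\<lambda>r. ereal ((1/2) * (poly_comp P F r + poly_comp P F (- r))
                                / (d * cartan_char F r)))"

end

theory Submission imports Defs begin

text \<open>Write \<open>g = P \<circ> f\<close>. Tropical Jensen gives
  \<open>N(r, -g) = (g(r) + g(-r)) / 2 - g(0) + N(r, g)\<close>, so both inequalities are in fact equalities
  once \<open>g(0)\<close> and \<open>N(r, g)\<close> are \<open>o(T\<^sub>f(r))\<close>. The slope jump of a maximum is at least that of
  one of its active terms, and the entire functions \<open>f\<^sub>i\<close> have nonnegative jumps, so every pole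
  of \<open>g\<close> comes from a coefficient and \<open>N(r, g) \<le> \<Sum>\<^sub>\<alpha> N(r, a\<^sub>\<alpha>)\<close>. Finally
  \<open>T\<^sub>f(r) \<rightarrow> \<infinity>\<close>: otherwise \<open>\<parallel>f\<parallel>\<close> has no roots, each \<open>f\<^sub>i - \<parallel>f\<parallel>\<close> is
  pole-free and bounded above, hence constant, and so is the curve \<open>f\<close>.\<close>

section \<open>One-sided slopes of a function at a point\<close>

text \<open>The left slope \<open>q\<close> comes first, the right slope \<open>p\<close> second.
  The equations are exact and involve \<open>g x\<close> itself, so continuity at \<open>x\<close>
  is built in, and sums, multiples and maxima reduce to combining \<open>eventually\<close>
  facts.\<close>

definition local_slopes :: "(real \<Rightarrow> real) \<Rightarrow> real \<Rightarrow> real \<Rightarrow> real \<Rightarrow> bool" where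
  "local_slopes g x q p \<longleftrightarrow>
     (\<forall>\<^sub>F h in at_right 0. g (x + h) = g x + p * h \<and> g (x - h) = g x - q * h)"

text \<open>A purely pointwise substitute for \<open>tropical_meromorphic\<close>: with no interval
  covers in it, closure under sums and maxima requires no common refinement.\<close>

definition locally_affine :: "(real \<Rightarrow> real) \<Rightarrow> bool" where
  "locally_affine g \<longleftrightarrow> (\<forall>x. \<exists>q p. local_slopes g x q p)"

lemma local_slopesD:
  assumes "local_slopes g x q p"
  obtains \<delta> where "\<delta> > 0"
    "\<And>y. x \<le> y \<Longrightarrow> y < x + \<delta> \<Longrightarrow> g y = g x + p * (y - x)"
    "\<And>y. x - \<delta> < y \<Longrightarrow> y \<le> x \<Longrightarrow> g y = g x + q * (y - x)"
proof -
  obtain \<delta> where "\<delta> > 0" and \<delta>: "\<And>h. 0 < h \<Longrightarrow> h < \<delta> \<Longrightarrow>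
      g (x + h) = g x + p * h \<and> g (x - h) = g x - q * h"
    using assms unfolding local_slopes_def eventually_at_right_field by auto
  show thesis
  proof (rule that[OF \<open>\<delta> > 0\<close>])
    fix y assume "x \<le> y" "y < x + \<delta>"
    then show "g y = g x + p * (y - x)" using \<delta>[of "y - x"] by (cases "y = x") auto
  next
    fix y assume "x - \<delta> < y" "y \<le> x"
    then show "g y = g x + q * (y - x)"
      using \<delta>[of "x - y"] by (cases "y = x") (auto simp: algebra_simps)
  qed
qed

lemma local_slopesI:
  assumes "\<delta> > 0"
    and "\<And>y. x < y \<Longrightarrow> y < x + \<delta> \<Longrightarrow> g y = g x + p * (y - x)"
    and "\<And>y. x - \<delta> < y \<Longrightarrow> y < x \<Longrightarrow> g y = g x + q * (y - x)"
  shows "local_slopes g x q p"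
  unfolding local_slopes_def eventually_at_right_field
proof (intro exI[of _ \<delta>] conjI allI impI)
  fix h :: real assume "0 < h" "h < \<delta>"
  then show "g (x + h) = g x + p * h" "g (x - h) = g x - q * h"
    using assms(2)[of "x + h"] assms(3)[of "x - h"] by auto
qed fact

text \<open>Points close to \<open>x\<close> but different from it lie inside a single affine piece.
  This and its mirror image show that slope jumps are isolated.\<close>

lemma local_slopes_right:
  assumes "local_slopes g x q p"
  shows "\<forall>\<^sub>F y in at_right x. local_slopes g y p p"
proof -
  from local_slopesD[OF assms] obtain \<delta> where d: "\<delta> > 0"
    and r: "\<And>y. x \<le> y \<Longrightarrow> y < x + \<delta> \<Longrightarrow> g y = g x + p * (y - x)" by metis
  have "local_slopes g y p p" if y: "x < y" "y < x + \<delta>" for y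
  proof -
    have eq: "g z = g y + p * (z - y)" if "x < z" "z < x + \<delta>" for z
      using r[of y] r[of z] y that by (simp add: algebra_simps)
    \<comment> \<open>The radius is the distance from \<open>y\<close> to the ends of the affine
      piece.\<close>
    show ?thesis
      using y by (intro local_slopesI[of "min (y - x) (x + \<delta> - y)"]) (auto intro!: eq)
  qed
  with d show ?thesis
    unfolding eventually_at_right_field by (intro exI[of _ "x + \<delta>"]) auto
qed

lemma local_slopes_left:
  assumes "local_slopes g x q p"
  shows "\<forall>\<^sub>F y in at_left x. local_slopes g y q q"
proof -
  from local_slopesD[OF assms] obtain \<delta> where d: "\<delta> > 0"
    and l: "\<And>y. x - \<delta> < y \<Longrightarrow> y \<le> x \<Longrightarrow> g y = g x + q * (y - x)" by metis
  have "local_slopes g y q q" if y: "x - \<delta> < y" "y < x" for y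
  proof -
    have eq: "g z = g y + q * (z - y)" if "x - \<delta> < z" "z < x" for z
      using l[of y] l[of z] y that by (simp add: algebra_simps)
    show ?thesis
      using y by (intro local_slopesI[of "min (x - y) (y - x + \<delta>)"]) (auto intro!: eq)
  qed
  with d show ?thesis
    unfolding eventually_at_left_field by (intro exI[of _ "x - \<delta>"]) auto
qed

lemma local_slopes_has_derivative:
  assumes "local_slopes g x p p"
  shows "(g has_real_derivative p) (at x)"
proof -
  from local_slopesD[OF assms] obtain \<delta> where d: "\<delta> > 0"
    and r: "\<And>y. x \<le> y \<Longrightarrow> y < x + \<delta> \<Longrightarrow> g y = g x + p * (y - x)"
    and l: "\<And>y. x - \<delta> < y \<Longrightarrow> y \<le> x \<Longrightarrow> g y = g x + p * (y - x)" by metis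
  have "((\<lambda>y. g x + p * (y - x)) has_real_derivative p) (at x)"
    by (auto intro!: derivative_eq_intros)
  then show ?thesis
  proof (rule has_field_derivative_transform_within_open)
    show "open {x - \<delta><..<x + \<delta>}" by simp
    show "x \<in> {x - \<delta><..<x + \<delta>}" using d by simp
    show "g x + p * (y - x) = g y" if "y \<in> {x - \<delta><..<x + \<delta>}" for y
      using that l[of y] r[of y] by (cases "x \<le> y") auto
  qed
qed

text \<open>Near \<open>x\<close> the derivative is constantly \<open>p\<close> on the right and
  \<open>q\<close> on the left, so the limit in \<open>slope_jump\<close> is that of an eventually
  constant function; \<open>deriv g x\<close> never enters.\<close>

lemma slope_jump_eq:
  assumes "local_slopes g x q p"
  shows "slope_jump g x = p - q"
proof -
  have r: "\<forall>\<^sub>F h in at_right 0. deriv g (x + h) = p"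
    using local_slopes_right[OF assms]
    unfolding eventually_at_right_to_0[of _ x]
    by eventually_elim
      (auto intro!: DERIV_imp_deriv local_slopes_has_derivative simp: add.commute)
  have l: "\<forall>\<^sub>F h in at_right 0. deriv g (x - h) = q"
    using local_slopes_left[OF assms]
    unfolding eventually_at_left_to_right[of _ x] eventually_at_right_to_0[of _ "-x"]
    by eventually_elim
      (auto intro!: DERIV_imp_deriv local_slopes_has_derivative)
  have "\<forall>\<^sub>F h in at_right 0. deriv g (x + h) - deriv g (x - h) = p - q"
    using r l by eventually_elim simp
  then have "((\<lambda>h. deriv g (x + h) - deriv g (x - h)) \<longlongrightarrow> p - q) (at_right 0)"
    by (rule tendsto_eventually)
  then show ?thesis
    unfolding slope_jump_def by (intro tendsto_Lim) auto
qed

lemma local_slopes_add: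
  assumes "local_slopes g x q p" "local_slopes h x q' p'"
  shows "local_slopes (\<lambda>y. g y + h y) x (q + q') (p + p')"
  using assms unfolding local_slopes_def
  by eventually_elim (auto simp: algebra_simps)

lemma local_slopes_scale:
  assumes "local_slopes g x q p"
  shows "local_slopes (\<lambda>y. c * g y) x (c * q) (c * p)"
  using assms unfolding local_slopes_def
  by eventually_elim (simp add: distrib_left right_diff_distrib mult.left_commute)

text \<open>These kinks serve as building blocks for Jensen's formula. The two conditionals differ
  only at \<open>x = b\<close>, where the jump is 2.\<close>

lemma local_slopes_abs:
  "local_slopes (\<lambda>y. \<bar>y - b\<bar>) x (if x \<le> b then -1 else 1) (if x < b then -1 else 1)"
  by (rule local_slopesI[of "if x = b then 1 else \<bar>x - b\<bar>"]) auto

text \<open>If the values at \<open>x\<close> differ, the larger function dominates nearby and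
  passes on its slopes. At a tie the maximum takes the larger right slope and the smaller left
  slope, so its jump is at least both given ones.\<close>

lemma local_slopes_max:
  assumes g: "local_slopes g x q p" and h: "local_slopes h x q' p'"
  obtains q'' p'' where "local_slopes (\<lambda>y. max (g y) (h y)) x q'' p''"
    "p - q \<le> p'' - q'' \<or> p' - q' \<le> p'' - q''"
proof -
  have tend: "((\<lambda>t. g x + a * t) \<longlongrightarrow> g x) (at_right 0)" for g :: "real \<Rightarrow> real" and a
    by (rule tendsto_eq_intros | simp)+
  have lt: "local_slopes (\<lambda>y. max (g y) (h y)) x q' p' \<and>
      local_slopes (\<lambda>y. max (h y) (g y)) x q' p'"
    if g: "local_slopes g x q p" and h: "local_slopes h x q' p'" and "g x < h x" for g h q p q' p'
  proof -
    have "\<forall>\<^sub>F t in at_right 0. g x + a * t < h x + b * t" for a b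
      using order_tendstoD(2)[OF tendsto_diff[OF tend[of g a] tend[of h b]], of 0] \<open>g x < h x\<close>
      by simp
    \<comment> \<open>The negated slopes treat the left side, where
      \<open>g (x - t) = g x - q * t\<close>.\<close>
    from this[of p p'] this[of "-q" "-q'"] g h
    show ?thesis
      unfolding local_slopes_def eventually_conj_iff[symmetric]
      by eventually_elim (use \<open>g x < h x\<close> in auto)
  qed
  consider "g x < h x" | "h x < g x" | "g x = h x" by linarith
  then show thesis
  proof cases
    case 1
    with lt[OF g h] that show ?thesis by blast
  next
    case 2
    with lt[OF h g] that show ?thesis by blast
  next
    case 3
    have "\<forall>\<^sub>F t::real in at_right 0. t > 0"
      by (auto simp: eventually_at_right_field intro: exI[of _ 1])
    with g h have "local_slopes (\<lambda>y. max (g y) (h y)) x (min q q') (max p p')"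
      unfolding local_slopes_def
      by eventually_elim (use 3 in \<open>auto simp: max_def min_def\<close>)
    then show ?thesis by (rule that) auto
  qed
qed

text \<open>Only one suitable index is claimed, since a term lying strictly below the maximum at
  \<open>x\<close> may have an arbitrarily large jump.\<close>

lemma local_slopes_Max:
  assumes "finite A" "A \<noteq> {}" "\<And>i. i \<in> A \<Longrightarrow> local_slopes (g i) x (q i) (p i)"
  shows "\<exists>i\<in>A. \<exists>q' p'. local_slopes (\<lambda>y. MAX i\<in>A. g i y) x q' p' \<and> p i - q i \<le> p' - q'"
  using assms
proof (induction A rule: finite_ne_induct)
  case (singleton i)
  then show ?case by auto
next
  case (insert i A)
  then obtain j q' p' where j: "j \<in> A" "p j - q j \<le> p' - q'"
    and s: "local_slopes (\<lambda>y. MAX i\<in>A. g i y) x q' p'" by auto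
  have "local_slopes (g i) x (q i) (p i)" using insert by auto
  from local_slopes_max[OF this s] obtain q'' p'' where
    "local_slopes (\<lambda>y. max (g i y) (MAX i\<in>A. g i y)) x q'' p''"
    "p i - q i \<le> p'' - q'' \<or> p' - q' \<le> p'' - q''" .
  moreover have "(\<lambda>y. max (g i y) (MAX i\<in>A. g i y)) = (\<lambda>y. MAX i\<in>insert i A. g i y)"
    using insert by (auto intro!: ext Max_insert[symmetric])
  ultimately show ?case
    using j by (metis insertCI order_trans)
qed

section \<open>Slope jumps of sums, multiples and maxima\<close>

lemma locally_affine_slopes:
  assumes "locally_affine g"
  obtains q where "local_slopes g x q (q + slope_jump g x)"
proof -
  obtain q p where *: "local_slopes g x q p"
    using assms unfolding locally_affine_def by blast
  from that[of q] slope_jump_eq[OF *] * show thesis by simp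
qed

lemma locally_affine_add:
  assumes "locally_affine g" "locally_affine h"
  shows "locally_affine (\<lambda>y. g y + h y)"
    and "slope_jump (\<lambda>y. g y + h y) x = slope_jump g x + slope_jump h x"
proof -
  have *: "\<exists>q. local_slopes (\<lambda>y. g y + h y) x q (q + (slope_jump g x + slope_jump h x))" for x
  proof -
    obtain q q' where "local_slopes g x q (q + slope_jump g x)"
      "local_slopes h x q' (q' + slope_jump h x)"
      using locally_affine_slopes assms by metis
    from local_slopes_add[OF this] show ?thesis
      by (intro exI[of _ "q + q'"]) (simp add: algebra_simps)
  qed
  then show "locally_affine (\<lambda>y. g y + h y)" unfolding locally_affine_def by blast
  from * show "slope_jump (\<lambda>y. g y + h y) x = slope_jump g x + slope_jump h x"
    using slope_jump_eq by fastforce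
qed

lemma locally_affine_scale:
  assumes "locally_affine g"
  shows "locally_affine (\<lambda>y. c * g y)"
    and "slope_jump (\<lambda>y. c * g y) x = c * slope_jump g x"
proof -
  have *: "\<exists>q. local_slopes (\<lambda>y. c * g y) x q (q + c * slope_jump g x)" for x
  proof -
    obtain q where "local_slopes g x q (q + slope_jump g x)"
      using locally_affine_slopes assms by metis
    from local_slopes_scale[OF this, of c] show ?thesis
      by (auto simp: distrib_left)
  qed
  then show "locally_affine (\<lambda>y. c * g y)" unfolding locally_affine_def by blast
  from * show "slope_jump (\<lambda>y. c * g y) x = c * slope_jump g x"
    using slope_jump_eq by fastforce
qed

lemma locally_affine_sum:
  assumes "finite A" "\<And>i. i \<in> A \<Longrightarrow> locally_affine (g i)"
  shows "locally_affine (\<lambda>y. \<Sum>i\<in>A. g i y) \<and>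
    slope_jump (\<lambda>y. \<Sum>i\<in>A. g i y) x = (\<Sum>i\<in>A. slope_jump (g i) x)"
  using assms
proof (induction A rule: finite_induct)
  case empty
  have "local_slopes (\<lambda>y. 0) x 0 0" for x by (simp add: local_slopes_def)
  then show ?case using slope_jump_eq unfolding locally_affine_def by fastforce
next
  case (insert i A)
  then show ?case using locally_affine_add[of "g i"] by simp
qed

lemma locally_affine_Max:
  assumes "finite A" "A \<noteq> {}" "\<And>i. i \<in> A \<Longrightarrow> locally_affine (g i)"
  shows "locally_affine (\<lambda>y. MAX i\<in>A. g i y)"
    and "\<exists>i\<in>A. slope_jump (g i) x \<le> slope_jump (\<lambda>y. MAX i\<in>A. g i y) x"
proof -
  have *: "\<exists>i\<in>A. \<exists>q' p'. local_slopes (\<lambda>y. MAX i\<in>A. g i y) x q' p' \<and>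
      slope_jump (g i) x \<le> p' - q'" for x
  proof -
    have "\<exists>q. \<forall>i\<in>A. local_slopes (g i) x (q i) (q i + slope_jump (g i) x)"
      using locally_affine_slopes[OF assms(3)] by (intro bchoice) blast
    then obtain q where "\<And>i. i \<in> A \<Longrightarrow> local_slopes (g i) x (q i) (q i + slope_jump (g i) x)"
      by blast
    from local_slopes_Max[OF assms(1,2) this] show ?thesis by simp
  qed
  then show "locally_affine (\<lambda>y. MAX i\<in>A. g i y)" unfolding locally_affine_def by blast
  from *[of x] show "\<exists>i\<in>A. slope_jump (g i) x \<le> slope_jump (\<lambda>y. MAX i\<in>A. g i y) x"
    using slope_jump_eq by metis
qed

section \<open>Tropical meromorphic functions are locally affine\<close>

text \<open>Of the finitely many intervals one accumulates at \<open>x\<close> from the right, so it contains a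
  right neighbourhood of \<open>x\<close>.\<close>

lemma tropical_meromorphic_right:
  assumes "tropical_meromorphic g"
  shows "\<exists>p. \<forall>\<^sub>F h in at_right 0. g (x + h) = g x + p * h"
proof -
  obtain \<J> where fin: "finite \<J>" and cov: "{x..x+1} \<subseteq> \<Union>\<J>"
    and J: "\<And>J. J \<in> \<J> \<Longrightarrow> is_interval J \<and> (\<exists>m c. \<forall>x\<in>J. g x = m * x + c)"
    using assms unfolding tropical_meromorphic_def by metis
  have "\<exists>J\<in>\<J>. \<exists>\<^sub>F y in at_right x. y \<in> J"
  proof (rule ccontr)
    assume "\<not> ?thesis"
    then have "\<forall>\<^sub>F y in at_right x. \<forall>J\<in>\<J>. y \<notin> J"
      using fin by (simp add: eventually_ball_finite_distrib not_frequently)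
    moreover have "\<forall>\<^sub>F y in at_right x. y \<in> {x..x+1}"
      by (auto simp: eventually_at_right_field intro: exI[of _ "x+1"])
    ultimately have "\<forall>\<^sub>F y in at_right x. False"
      by eventually_elim (use cov in blast)
    then show False by simp
  qed
  then obtain J m c where freq: "\<exists>\<^sub>F y in at_right x. y \<in> J" and int: "is_interval J"
    and mc: "\<And>y. y \<in> J \<Longrightarrow> g y = m * y + c" using J by blast
  have near: "\<exists>z\<in>J. x < z \<and> z < y" if "x < y" for y
    using freq that unfolding frequently_def eventually_at_right_field by blast
  obtain y0 where y0: "y0 \<in> J" "x < y0" using near[of "x+1"] by auto
  \<comment> \<open>Such a \<open>y\<close> lies between \<open>y0\<close> and a point of
    \<open>J\<close> even closer to \<open>x\<close>, and \<open>J\<close> is an interval.\<close>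
  have "y \<in> J" if "x < y" "y < y0" for y
    using near[OF \<open>x < y\<close>] y0 int that mem_is_interval_1_I[of J _ y0 y] by force
  then have ev: "\<forall>\<^sub>F y in at_right x. g y = m * y + c"
    using y0 mc unfolding eventually_at_right_field by blast
  \<comment> \<open>The point \<open>x\<close> need not belong to \<open>J\<close>; continuity
    carries the affine formula over to it.\<close>
  have "isCont g x"
    using assms by (simp add: tropical_meromorphic_def continuous_on_eq_continuous_at)
  then have "(g \<longlongrightarrow> g x) (at_right x)"
    by (simp add: continuous_at_imp_continuous_at_within continuous_within[symmetric])
  moreover have "((\<lambda>y. m * y + c) \<longlongrightarrow> m * x + c) (at_right x)"
    by (intro tendsto_intros)
  then have "(g \<longlongrightarrow> m * x + c) (at_right x)"
    by (rule Lim_transform_eventually) (use ev in \<open>eventually_elim, simp\<close>)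
  ultimately have gx: "g x = m * x + c"
    by (rule tendsto_unique[rotated]) simp
  show ?thesis
    using ev unfolding eventually_at_right_to_0[of _ x]
    by (intro exI[of _ m]) (auto elim!: eventually_mono simp: gx algebra_simps)
qed

text \<open>Reflection lets the result on right slopes also produce left slopes.\<close>

lemma tropical_meromorphic_uminus_arg:
  assumes "tropical_meromorphic g"
  shows "tropical_meromorphic (\<lambda>x. g (- x))"
  unfolding tropical_meromorphic_def
proof (intro conjI allI)
  show "continuous_on UNIV (\<lambda>x. g (- x))"
    using assms unfolding tropical_meromorphic_def
    by (intro continuous_on_compose2[of UNIV g UNIV uminus]) (simp_all add: continuous_on_minus)
next
  fix a b :: real
  obtain \<J> where fin: "finite \<J>" and cov: "{-b..-a} \<subseteq> \<Union>\<J>"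
    and J: "\<And>J. J \<in> \<J> \<Longrightarrow> is_interval J \<and> (\<exists>m c. \<forall>x\<in>J. g x = m * x + c)"
    using assms unfolding tropical_meromorphic_def by metis
  have "{a..b} \<subseteq> \<Union>((`) uminus ` \<J>)"
  proof
    fix x assume "x \<in> {a..b}"
    then have "- x \<in> {-b..-a}" by auto
    then have "- x \<in> \<Union>\<J>" using cov by blast
    then show "x \<in> \<Union>((`) uminus ` \<J>)" by force
  qed
  moreover have "is_interval (uminus ` J) \<and> (\<exists>m c. \<forall>x\<in>uminus ` J. g (- x) = m * x + c)"
    if "J \<in> \<J>" for J
  proof -
    obtain m c where "\<forall>x\<in>J. g x = m * x + c" using J[OF \<open>J \<in> \<J>\<close>] by blast
    then have "\<forall>x\<in>uminus ` J. g (- x) = (- m) * x + c" by auto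
    with J[OF \<open>J \<in> \<J>\<close>] show ?thesis unfolding is_interval_uminus by blast
  qed
  ultimately show "\<exists>\<J>. finite \<J> \<and> {a..b} \<subseteq> \<Union>\<J> \<and>
      (\<forall>J\<in>\<J>. is_interval J \<and> (\<exists>m c. \<forall>x\<in>J. g (- x) = m * x + c))"
    using fin by (intro exI[of _ "(`) uminus ` \<J>"]) auto
qed

lemma tropical_meromorphic_imp_locally_affine:
  assumes "tropical_meromorphic g"
  shows "locally_affine g"
  unfolding locally_affine_def
proof
  fix x
  obtain p where p: "\<forall>\<^sub>F h in at_right 0. g (x + h) = g x + p * h"
    using tropical_meromorphic_right[OF assms] by blast
  obtain q where q: "\<forall>\<^sub>F h in at_right 0. g (- (- x + h)) = g (- (- x)) + q * h"
    using tropical_meromorphic_right[OF tropical_meromorphic_uminus_arg[OF assms]] by blast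
  \<comment> \<open>Reflection reverses the sign of a slope: \<open>q\<close> is the right slope of
    the reflected function at \<open>- x\<close>.\<close>
  have "local_slopes g x (- q) p"
    unfolding local_slopes_def using p q by eventually_elim simp
  then show "\<exists>q p. local_slopes g x q p" by blast
qed

section \<open>Tropical Jensen formula and comparison of pole counts\<close>

text \<open>Without jumps \<open>deriv g\<close> is locally constant, hence equal to some
  \<open>m\<close> on the convex set; then \<open>g x - m * x\<close> has derivative zero. The
  slopes at a point of \<open>S\<close> describe \<open>g\<close> on a full neighbourhood, so
  endpoints of \<open>S\<close> are no exception.\<close>

lemma affine_if_no_slope_jump:
  assumes S: "convex S" and g: "locally_affine g" and 0: "\<And>x. x \<in> S \<Longrightarrow> slope_jump g x = 0"
  obtains m c where "\<And>x. x \<in> S \<Longrightarrow> g x = m * x + c"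
proof -
  have loc: "\<exists>p. local_slopes g x p p" if "x \<in> S" for x
    using locally_affine_slopes[OF g, of x] 0[OF that] by auto
  have "(deriv g has_real_derivative 0) (at x within S)" if x: "x \<in> S" for x
  proof -
    obtain p where p: "local_slopes g x p p" using loc[OF x] by blast
    then have "\<forall>\<^sub>F y in at x. local_slopes g y p p"
      using local_slopes_left local_slopes_right by (simp add: eventually_at_split)
    then have "\<forall>\<^sub>F y in at x. deriv g y = p"
      by eventually_elim (simp add: DERIV_imp_deriv local_slopes_has_derivative)
    then have "\<forall>\<^sub>F y in nhds x. deriv g y = p"
      unfolding eventually_nhds_conv_at
      using DERIV_imp_deriv[OF local_slopes_has_derivative[OF p]] by blast
    then have "(deriv g has_real_derivative 0) (at x)"
      using DERIV_cong_ev[OF refl _ refl, of "deriv g" "\<lambda>_. p" x 0] by simp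
    then show ?thesis by (rule has_field_derivative_at_within)
  qed
  from has_field_derivative_zero_constant[OF S this]
  obtain m where m: "\<And>x. x \<in> S \<Longrightarrow> deriv g x = m" by blast
  have "((\<lambda>x. g x - m * x) has_real_derivative 0) (at x within S)" if x: "x \<in> S" for x
  proof -
    have "(g has_real_derivative m) (at x)"
      using loc[OF x] m[OF x] local_slopes_has_derivative DERIV_imp_deriv by metis
    then show ?thesis
      by (auto intro!: derivative_eq_intros intro: has_field_derivative_at_within)
  qed
  from has_field_derivative_zero_constant[OF S this]
  obtain c where "\<And>x. x \<in> S \<Longrightarrow> g x - m * x = c" by blast
  then show thesis by (intro that[of m c]) (auto simp: algebra_simps)
qed

text \<open>Infinitely many jumps in a compact set would accumulate at some \<open>x\<close>, yet
  the two affine pieces meeting at \<open>x\<close> leave a punctured neighbourhood free of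
  jumps.\<close>

lemma finite_slope_jumps:
  assumes g: "locally_affine g" and K: "compact K"
  shows "finite {b \<in> K. slope_jump g b \<noteq> 0}"
proof (rule ccontr)
  assume "infinite {b \<in> K. slope_jump g b \<noteq> 0}"
  moreover have "{b \<in> K. slope_jump g b \<noteq> 0} \<subseteq> K" by blast
  ultimately obtain x where x: "x islimpt {b \<in> K. slope_jump g b \<noteq> 0}"
    using K unfolding compact_eq_Bolzano_Weierstrass by blast
  obtain q p where "local_slopes g x q p" using g unfolding locally_affine_def by blast
  from local_slopes_left[OF this] local_slopes_right[OF this]
  have "\<forall>\<^sub>F y in at_left x. slope_jump g y = 0" "\<forall>\<^sub>F y in at_right x. slope_jump g y = 0"
    by (auto elim!: eventually_mono dest: slope_jump_eq)
  then have "\<forall>\<^sub>F y in at x. slope_jump g y = 0" by (simp add: eventually_at_split)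
  then have "\<forall>\<^sub>F y in at x. \<not> (y \<in> {b \<in> K. slope_jump g b \<noteq> 0})"
    by (rule eventually_mono) simp
  with x show False
    unfolding islimpt_conv_frequently_at frequently_def by contradiction
qed

text \<open>Subtracting \<open>\<omega>\<^sub>g(b) \<bar>x - b\<bar> / 2\<close> for all \<open>b \<in> [-r,r]\<close> removes every slope jump there,
  leaving an affine function.\<close>

lemma tropical_jensen_sum:
  assumes g: "locally_affine g" and "r > 0"
    and K: "finite K" "K \<subseteq> {-r..r}" "{b. slope_jump g b \<noteq> 0 \<and> \<bar>b\<bar> \<le> r} \<subseteq> K"
  shows "g r + g (- r) = 2 * g 0 + (\<Sum>b\<in>K. slope_jump g b * (r - \<bar>b\<bar>))"
proof -
  define s where "s x = (\<Sum>b\<in>K. - slope_jump g b / 2 * \<bar>x - b\<bar>)" for x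
  have abs: "locally_affine (\<lambda>y. \<bar>y - b\<bar>)"
      "slope_jump (\<lambda>y. \<bar>y - b\<bar>) x = (if x = b then 2 else 0)" for b x
    using local_slopes_abs slope_jump_eq[OF local_slopes_abs]
    unfolding locally_affine_def by auto
  have s: "locally_affine s \<and> slope_jump s x = (\<Sum>b\<in>K. slope_jump (\<lambda>x. - slope_jump g b / 2 * \<bar>x - b\<bar>) x)" for x
    unfolding s_def by (intro locally_affine_sum K(1) locally_affine_scale abs)
  have jump_s: "slope_jump s x = (if x \<in> K then - slope_jump g x else 0)" for x
  proof -
    have "slope_jump (\<lambda>x. - slope_jump g b / 2 * \<bar>x - b\<bar>) x =
        (if x = b then - slope_jump g b else 0)" for b
      unfolding locally_affine_scale(2)[OF abs(1)] abs(2) by simp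
    then show ?thesis using s[of x] K(1) by simp
  qed
  have la_s: "locally_affine s" using s by blast
  have "slope_jump (\<lambda>x. g x + s x) x = 0" if "x \<in> {-r..r}" for x
  proof -
    have "slope_jump g x = 0" if "x \<notin> K"
      using K(3) that \<open>x \<in> {-r..r}\<close> by (auto simp: abs_le_iff)
    then show ?thesis
      unfolding locally_affine_add(2)[OF g la_s] jump_s by simp
  qed
  from affine_if_no_slope_jump[OF convex_real_interval(5) locally_affine_add(1)[OF g la_s] this]
  obtain m c where mc: "\<And>x. x \<in> {-r..r} \<Longrightarrow> g x + s x = m * x + c"
    by blast
  \<comment> \<open>This second difference annihilates the affine function
    \<open>m * x + c\<close>.\<close>
  have "g r + g (- r) - 2 * g 0 = 2 * s 0 - s r - s (- r)"
    using mc[of r] mc[of "-r"] mc[of 0] \<open>r > 0\<close> by simp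
  also have "\<dots> = (\<Sum>b\<in>K. slope_jump g b * (r - \<bar>b\<bar>))"
    unfolding s_def sum_distrib_left sum_subtractf[symmetric]
  proof (rule sum.cong[OF refl])
    fix b assume "b \<in> K"
    \<comment> \<open>For \<open>b\<close> in the interval the distances to \<open>r\<close> and
      \<open>- r\<close> add up to \<open>2 * r\<close>, which produces the weight
      \<open>r - \<bar>b\<bar>\<close>.\<close>
    then have "\<bar>r - b\<bar> = r - b" "\<bar>- r - b\<bar> = r + b" using K(2) by auto
    then show "2 * (- slope_jump g b / 2 * \<bar>0 - b\<bar>) - - slope_jump g b / 2 * \<bar>r - b\<bar>
        - - slope_jump g b / 2 * \<bar>- r - b\<bar> = slope_jump g b * (r - \<bar>b\<bar>)"
      by (simp add: field_simps)
  qed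
  finally show ?thesis by simp
qed

text \<open>\<open>K\<close> may be larger than the set of poles, so that several functions can be
  compared over one index set. The extra points contribute nothing: either the negative part of the
  jump vanishes or \<open>\<bar>b\<bar> = r\<close>.\<close>

lemma pole_counting_eq_sum:
  assumes "finite K" "K \<subseteq> {-r..r}" "{b. slope_jump g b \<noteq> 0 \<and> \<bar>b\<bar> \<le> r} \<subseteq> K"
  shows "pole_counting r g = (1/2) * (\<Sum>b\<in>K. max 0 (- slope_jump g b) * (r - \<bar>b\<bar>))"
proof -
  have "(\<Sum>b | tropical_pole g b \<and> \<bar>b\<bar> < r. tropical_multiplicity g b * (r - \<bar>b\<bar>)) =
      (\<Sum>b\<in>K. max 0 (- slope_jump g b) * (r - \<bar>b\<bar>))"
  proof (rule sum.mono_neutral_cong_left)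
    show "{b. tropical_pole g b \<and> \<bar>b\<bar> < r} \<subseteq> K"
      using assms(3) by (auto simp: tropical_pole_def)
    show "\<forall>b\<in>K - {b. tropical_pole g b \<and> \<bar>b\<bar> < r}.
        max 0 (- slope_jump g b) * (r - \<bar>b\<bar>) = 0"
    proof
      fix b assume b: "b \<in> K - {b. tropical_pole g b \<and> \<bar>b\<bar> < r}"
      then have "\<bar>b\<bar> \<le> r" using assms(2) by (auto simp: abs_le_iff)
      with b show "max 0 (- slope_jump g b) * (r - \<bar>b\<bar>) = 0"
        by (auto simp: tropical_pole_def not_less)
    qed
  qed (use assms in \<open>auto simp: tropical_multiplicity_def tropical_pole_def\<close>)
  then show ?thesis by (simp add: pole_counting_def)
qed

text \<open>The roots of \<open>g\<close> are the poles of its negative, and a jump is its positive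
  part minus its negative part; this splits the weighted sum of jumps into two pole counts.\<close>

lemma tropical_jensen:
  assumes g: "locally_affine g" and "r > 0"
  shows "(g r + g (- r)) / 2 = g 0 + pole_counting r (\<lambda>x. - g x) - pole_counting r g"
proof -
  define K where "K = {b \<in> {-r..r}. slope_jump g b \<noteq> 0}"
  have K: "finite K" "K \<subseteq> {-r..r}" "{b. slope_jump g b \<noteq> 0 \<and> \<bar>b\<bar> \<le> r} \<subseteq> K"
    using finite_slope_jumps[OF g compact_Icc] by (auto simp: K_def)
  have neg: "slope_jump (\<lambda>x. - g x) b = - slope_jump g b" for b
    using locally_affine_scale(2)[OF g, of "-1" b] by simp
  have "pole_counting r (\<lambda>x. - g x) - pole_counting r g = 
      (1/2) * (\<Sum>b\<in>K. slope_jump g b * (r - \<bar>b\<bar>))"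
  proof -
    have "pole_counting r (\<lambda>x. - g x) = (1/2) * (\<Sum>b\<in>K. max 0 (slope_jump g b) * (r - \<bar>b\<bar>))"
      using pole_counting_eq_sum[of K r "\<lambda>x. - g x"] K by (simp add: neg)
    moreover have "(\<Sum>b\<in>K. max 0 (slope_jump g b) * (r - \<bar>b\<bar>)) -
        (\<Sum>b\<in>K. max 0 (- slope_jump g b) * (r - \<bar>b\<bar>)) = (\<Sum>b\<in>K. slope_jump g b * (r - \<bar>b\<bar>))"
      unfolding sum_subtractf[symmetric] left_diff_distrib[symmetric]
      by (rule sum.cong) (auto simp: max_def)
    ultimately show ?thesis
      unfolding pole_counting_eq_sum[OF K] by simp
  qed
  with tropical_jensen_sum[OF g \<open>r > 0\<close> K] show ?thesis by simp
qed

lemma pole_counting_nonneg: "pole_counting r g \<ge> 0"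
  unfolding pole_counting_def
  by (auto intro!: sum_nonneg mult_nonneg_nonneg simp: tropical_multiplicity_def)

text \<open>At each point the negative part of the jump of \<open>g\<close> is at most that of some
  \<open>a i\<close>. As \<open>i\<close> varies with the point, it is bounded by the sum over all
  \<open>i\<close>, whose terms are nonnegative.\<close>

lemma pole_counting_le_sum:
  assumes "finite A" "\<And>i. i \<in> A \<Longrightarrow> locally_affine (a i)" "locally_affine g"
    and le: "\<And>b. \<exists>i\<in>A. slope_jump (a i) b \<le> slope_jump g b"
  shows "pole_counting r g \<le> (\<Sum>i\<in>A. pole_counting r (a i))"
proof -
  define K where "K = {b \<in> {-r..r}. slope_jump g b \<noteq> 0} \<union>
    (\<Union>i\<in>A. {b \<in> {-r..r}. slope_jump (a i) b \<noteq> 0})"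
  have K: "finite K" "K \<subseteq> {-r..r}" "{b. slope_jump g b \<noteq> 0 \<and> \<bar>b\<bar> \<le> r} \<subseteq> K"
    using finite_slope_jumps[OF _ compact_Icc] assms(1-3) by (auto simp: K_def)
  have Ka: "{b. slope_jump (a i) b \<noteq> 0 \<and> \<bar>b\<bar> \<le> r} \<subseteq> K" if "i \<in> A" for i
    using that by (auto simp: K_def)
  have "(\<Sum>b\<in>K. max 0 (- slope_jump g b) * (r - \<bar>b\<bar>)) \<le>
      (\<Sum>b\<in>K. \<Sum>i\<in>A. max 0 (- slope_jump (a i) b) * (r - \<bar>b\<bar>))"
  proof (rule sum_mono)
    fix b assume "b \<in> K"
    then have b: "0 \<le> r - \<bar>b\<bar>" using K(2) by (auto simp: abs_le_iff)
    obtain i where i: "i \<in> A" "slope_jump (a i) b \<le> slope_jump g b" using le by blast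
    have "max 0 (- slope_jump g b) * (r - \<bar>b\<bar>) \<le> max 0 (- slope_jump (a i) b) * (r - \<bar>b\<bar>)"
      using i b by (intro mult_right_mono) auto
    also have "\<dots> \<le> (\<Sum>i\<in>A. max 0 (- slope_jump (a i) b) * (r - \<bar>b\<bar>))"
      using i b assms(1) by (intro member_le_sum) auto
    finally show "max 0 (- slope_jump g b) * (r - \<bar>b\<bar>) \<le> \<dots>" .
  qed
  also have "\<dots> = (\<Sum>i\<in>A. \<Sum>b\<in>K. max 0 (- slope_jump (a i) b) * (r - \<bar>b\<bar>))"
    by (rule sum.swap)
  finally show ?thesis
    unfolding pole_counting_eq_sum[OF K] using pole_counting_eq_sum[OF K(1,2) Ka]
    by (simp add: sum_distrib_right)
qed

section \<open>Growth of symmetric means and of the Cartan characteristic\<close>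

text \<open>All terms in Jensen's sum are nonnegative, so a single one may be kept. It grows
  linearly in \<open>r\<close> if \<open>b\<close> is a root.\<close>

lemma mean_lower_bound:
  assumes g: "locally_affine g" and pos: "\<And>x. slope_jump g x \<ge> 0" and r: "r > 0" "\<bar>b\<bar> \<le> r"
  shows "g 0 + slope_jump g b / 2 * (r - \<bar>b\<bar>) \<le> (g r + g (- r)) / 2"
proof -
  \<comment> \<open>Inserting \<open>b\<close> guarantees its term in the sum even if the jump there
    is zero.\<close>
  define K where "K = insert b {b \<in> {-r..r}. slope_jump g b \<noteq> 0}"
  have K: "finite K" "K \<subseteq> {-r..r}" "{b. slope_jump g b \<noteq> 0 \<and> \<bar>b\<bar> \<le> r} \<subseteq> K"
    using finite_slope_jumps[OF g compact_Icc] r by (auto simp: K_def)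
  have "slope_jump g b * (r - \<bar>b\<bar>) \<le> (\<Sum>b\<in>K. slope_jump g b * (r - \<bar>b\<bar>))"
    by (rule member_le_sum[OF _ _ K(1), where f = "\<lambda>b. slope_jump g b * (r - \<bar>b\<bar>)"])
      (use K pos in \<open>auto simp: K_def intro!: mult_nonneg_nonneg\<close>)
  with tropical_jensen_sum[OF g \<open>r > 0\<close> K] show ?thesis by simp
qed

lemma mean_at_top:
  assumes g: "locally_affine g" and pos: "\<And>x. slope_jump g x \<ge> 0" and b: "slope_jump g b > 0"
  shows "filterlim (\<lambda>r. (g r + g (- r)) / 2) at_top at_top"
proof (rule filterlim_at_top_mono)
  have "filterlim (\<lambda>r. r + - \<bar>b\<bar>) at_top at_top"
    using filterlim_tendsto_add_at_top[OF tendsto_const filterlim_ident, of "- \<bar>b\<bar>"]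
    by (simp add: add.commute)
  then have "filterlim (\<lambda>r. slope_jump g b / 2 * (r + - \<bar>b\<bar>)) at_top at_top"
    using b by (intro filterlim_tendsto_pos_mult_at_top[OF tendsto_const]) auto
  then show "filterlim (\<lambda>r. g 0 + slope_jump g b / 2 * (r + - \<bar>b\<bar>)) at_top at_top"
    by (rule filterlim_tendsto_add_at_top[OF tendsto_const])
  show "\<forall>\<^sub>F r in at_top. g 0 + slope_jump g b / 2 * (r + - \<bar>b\<bar>) \<le> (g r + g (- r)) / 2"
    using eventually_gt_at_top[of "0::real"] eventually_ge_at_top[of "\<bar>b\<bar>"]
    by eventually_elim (use mean_lower_bound[OF g pos] in simp)
qed

text \<open>A Liouville theorem: one root would make the symmetric means unbounded, so
  \<open>g\<close> is affine, and an affine function bounded above is constant.\<close>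

lemma bounded_above_no_poles_const:
  assumes g: "locally_affine g" and pos: "\<And>x. slope_jump g x \<ge> 0" and bd: "\<And>x. g x \<le> B"
  shows "g x = g 0"
proof -
  have "slope_jump g b = 0" for b
  proof (rule ccontr)
    assume "slope_jump g b \<noteq> 0"
    with pos[of b] have "slope_jump g b > 0" by simp
    from mean_at_top[OF g pos this] have "\<forall>\<^sub>F r in at_top. B < (g r + g (- r)) / 2"
      by (simp add: filterlim_at_top_dense)
    then obtain r where "B < (g r + g (- r)) / 2"
      using eventually_happens by force
    with bd[of r] bd[of "-r"] show False by simp
  qed
  with affine_if_no_slope_jump[OF convex_UNIV g] obtain m c where mc: "\<And>x. g x = m * x + c"
    by auto
  \<comment> \<open>For nonzero \<open>m\<close> the affine function takes the value
    \<open>B + 1\<close> at the chosen point.\<close>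
  have "m = 0"
    using bd[of "(B - c + 1) / m"] by (auto simp: mc split: if_splits)
  with mc show ?thesis by simp
qed

lemma cartan_char_at_top:
  fixes f :: "real \<Rightarrow> 'n::finite tropical_proj"
  assumes red: "reduced_representation f F" and nc: "\<not> f constant_on UNIV"
  shows "filterlim (cartan_char F) at_top at_top"
proof -
  define M where "M = curve_norm F"
  have M_Max: "M = (\<lambda>y. MAX i\<in>UNIV. F i y)" by (simp add: M_def curve_norm_def fun_eq_iff)
  have F: "locally_affine (F i)" "slope_jump (F i) x \<ge> 0" for i x
    using red tropical_meromorphic_imp_locally_affine
    by (auto simp: reduced_representation_def tropical_entire_def tropical_pole_def not_less)
  have M: "locally_affine M" "slope_jump M x \<ge> 0" for x
  proof -
    show "locally_affine M"
      unfolding M_Max using F(1) by (intro locally_affine_Max) auto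
    obtain i where "slope_jump (F i) x \<le> slope_jump M x"
      unfolding M_Max using locally_affine_Max(2)[of "UNIV :: 'n set" F x] F(1) by auto
    with F(2)[of i x] show "slope_jump M x \<ge> 0" by linarith
  qed
  have "\<exists>b. slope_jump M b > 0"
  proof (rule ccontr)
    assume "\<not> ?thesis"
    with M(2) have M0: "slope_jump M b = 0" for b by (metis less_eq_real_def)
    \<comment> \<open>Since \<open>M\<close> has no jumps, subtracting it creates no poles, and
      \<open>F i \<le> M\<close> gives the upper bound 0.\<close>
    have D: "F i x - M x = F i 0 - M 0" for i x
    proof -
      have neg: "locally_affine (\<lambda>x. - M x)" "slope_jump (\<lambda>x. - M x) b = 0" for b
        using locally_affine_scale[OF M(1), of "-1"] M0 by auto
      have le: "F i x \<le> M x" for x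
        unfolding M_Max by (intro Max_ge) auto
      have "F i x + - M x = F i 0 + - M 0"
        by (rule bounded_above_no_poles_const[where g = "\<lambda>x. F i x + - M x" and B = 0])
          (use F neg(2) le locally_affine_add[OF F(1) neg(1)] in auto)
      then show ?thesis by simp
    qed
    have "f x = f 0" for x
    proof -
      \<comment> \<open>By \<open>D\<close>, passing from \<open>x\<close> to 0 adds
        \<open>M 0 - M x\<close> to every coordinate, the same constant for all
        \<open>i\<close>.\<close>
      have "tropical_proj_rel (\<lambda>i. ereal (F i x)) (\<lambda>i. ereal (F i 0))"
        unfolding tropical_proj_rel_def tropical_coords_def
        using D[of _ x] by (auto intro!: exI[of _ "M 0 - M x"] simp: algebra_simps)
      then show ?thesis
        using red Quotient3_rel_abs[OF Quotient3_tropical_proj]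
        by (simp add: reduced_representation_def)
    qed
    with nc show False by (auto simp: constant_on_def)
  qed
  then obtain b where "slope_jump M b > 0" by blast
  from mean_at_top[OF M this] show ?thesis
    by (simp add: cartan_char_def[abs_def] M_def)
qed

section \<open>Asymptotic comparison and the final estimate\<close>

text \<open>The limits may be infinite, so they are compared through thresholds instead of being
  subtracted: a real \<open>z\<close> between \<open>y\<close> and the lower limit of
  \<open>u\<close> leaves a gap that absorbs the vanishing error.\<close>

lemma Liminf_ereal_mono_asymp:
  fixes u v :: "'a \<Rightarrow> real"
  assumes "((\<lambda>r. v r - u r) \<longlongrightarrow> 0) G"
  shows "Liminf G (\<lambda>r. ereal (u r)) \<le> Liminf G (\<lambda>r. ereal (v r))"
  unfolding le_Liminf_iff
proof (intro allI impI)
  fix y assume "y < Liminf G (\<lambda>r. ereal (u r))"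
  then obtain z where z: "y < ereal z" "ereal z < Liminf G (\<lambda>r. ereal (u r))"
    using ereal_dense2 by blast
  from z(2) have ev: "\<forall>\<^sub>F r in G. z < u r"
    using less_LiminfD by fastforce
  show "\<forall>\<^sub>F r in G. y < ereal (v r)"
  proof (cases y)
    case (real y')
    with z(1) have "\<forall>\<^sub>F r in G. y' - z < v r - u r"
      by (intro order_tendstoD(1)[OF assms]) simp
    with ev show ?thesis by eventually_elim (simp add: real)
  qed (use z in auto)
qed

lemma Limsup_ereal_mono_asymp:
  fixes u v :: "'a \<Rightarrow> real"
  assumes "((\<lambda>r. v r - u r) \<longlongrightarrow> 0) G"
  shows "Limsup G (\<lambda>r. ereal (v r)) \<le> Limsup G (\<lambda>r. ereal (u r))"
proof -
  have "Liminf G (\<lambda>r. ereal (- u r)) \<le> Liminf G (\<lambda>r. ereal (- v r))"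
    by (rule Liminf_ereal_mono_asymp) (use tendsto_minus[OF assms] in \<open>simp add: algebra_simps\<close>)
  then show ?thesis
    unfolding uminus_ereal.simps(1)[symmetric] ereal_Liminf_uminus by simp
qed

theorem theorem3p3:
  fixes f :: "real \<Rightarrow> 'n::finite tropical_proj"
    and F :: "'n \<Rightarrow> real \<Rightarrow> real"
    and P :: "'n tropical_poly"
    and d :: real
  assumes "reduced_representation f F"
    and "\<not> f constant_on UNIV"
    and "homogeneous_tropical_poly d P"
    and "P \<noteq> Map.empty"
    and "\<And>a. a \<in> ran P \<Longrightarrow> (\<lambda>r. pole_counting r a) \<in> o[at_top](\<lambda>r. cartan_char F r)"
  shows "lower_psi d P F
           \<le> Liminf at_top (\<lambda>r. ereal (pole_counting r (\<lambda>x. - poly_comp P F x)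
                                          / (d * cartan_char F r)))
       \<and> Limsup at_top (\<lambda>r. ereal (pole_counting r (\<lambda>x. - poly_comp P F x)
                                       / (d * cartan_char F r)))
           \<le> upper_psi d P F"
proof -
  define g where "g = poly_comp P F"
  define T where "T = cartan_char F"
  define a where "a \<alpha> = the (P \<alpha>)" for \<alpha>
  define h where "h \<alpha> x = a \<alpha> x + (\<Sum>i\<in>UNIV. \<alpha> i * F i x)" for \<alpha> x
  have g_Max: "g = (\<lambda>x. MAX \<alpha>\<in>dom P. h \<alpha> x)"
    by (simp add: g_def poly_comp_def h_def a_def fun_eq_iff)
  have T: "filterlim T at_top at_top"
    using cartan_char_at_top[OF assms(1,2)] by (simp add: T_def)
  have d: "d > 0" and fin: "finite (dom P)" and ne: "dom P \<noteq> {}"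
    and exp: "\<And>\<alpha> i. \<alpha> \<in> dom P \<Longrightarrow> 0 \<le> \<alpha> i"
    using assms(3,4) by (auto simp: homogeneous_tropical_poly_def)
  have a_ran: "a \<alpha> \<in> ran P" if "\<alpha> \<in> dom P" for \<alpha>
    using that by (auto simp: a_def ran_def)
  then have a: "locally_affine (a \<alpha>)" if "\<alpha> \<in> dom P" for \<alpha>
    using assms(3) that tropical_meromorphic_imp_locally_affine
    by (auto simp: homogeneous_tropical_poly_def)
  have F: "locally_affine (F i)" "slope_jump (F i) x \<ge> 0" for i x
    using assms(1) tropical_meromorphic_imp_locally_affine
    by (auto simp: reduced_representation_def tropical_entire_def tropical_pole_def not_less)
  have h: "locally_affine (h \<alpha>)" "slope_jump (a \<alpha>) x \<le> slope_jump (h \<alpha>) x"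
    if "\<alpha> \<in> dom P" for \<alpha> x
  proof -
    have *: "locally_affine (\<lambda>y. \<Sum>i\<in>UNIV. \<alpha> i * F i y) \<and>
        slope_jump (\<lambda>y. \<Sum>i\<in>UNIV. \<alpha> i * F i y) x = (\<Sum>i\<in>UNIV. slope_jump (\<lambda>y. \<alpha> i * F i y) x)" for x
      by (intro locally_affine_sum locally_affine_scale F) auto
    \<comment> \<open>Exponents are nonnegative and the \<open>F i\<close> have no poles, so the
      linear part of a term can only raise the jump of its coefficient.\<close>
    have "0 \<le> slope_jump (\<lambda>y. \<Sum>i\<in>UNIV. \<alpha> i * F i y) x"
      using * locally_affine_scale(2)[OF F(1)] F(2) exp[OF that]
      by (auto intro!: sum_nonneg)
    with locally_affine_add[OF a[OF that], of "\<lambda>y. \<Sum>i\<in>UNIV. \<alpha> i * F i y"] *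
    show "locally_affine (h \<alpha>)" "slope_jump (a \<alpha>) x \<le> slope_jump (h \<alpha>) x"
      by (auto simp: h_def[abs_def])
  qed
  have g: "locally_affine g"
    unfolding g_Max using fin ne h(1) by (rule locally_affine_Max)
  have "\<exists>\<alpha>\<in>dom P. slope_jump (a \<alpha>) x \<le> slope_jump g x" for x
    unfolding g_Max using locally_affine_Max(2)[OF fin ne h(1), where x = x] h(2)
    by (meson order_trans)
  from pole_counting_le_sum[OF fin a g this]
  have N_le: "pole_counting r g \<le> (\<Sum>\<alpha>\<in>dom P. pole_counting r (a \<alpha>))" for r by blast
  have T_pos: "\<forall>\<^sub>F r in at_top. T r > 0"
    using T by (simp add: filterlim_at_top_dense)
  have "((\<lambda>r. pole_counting r g / T r) \<longlongrightarrow> 0) at_top"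
  proof (rule tendsto_sandwich[where f = "\<lambda>_. 0"])
    show "((\<lambda>r. \<Sum>\<alpha>\<in>dom P. pole_counting r (a \<alpha>) / T r) \<longlongrightarrow> 0) at_top"
      using assms(5)[OF a_ran] by (intro tendsto_null_sum) (auto simp: T_def dest: smalloD_tendsto)
    show "\<forall>\<^sub>F r in at_top. 0 \<le> pole_counting r g / T r"
      using T_pos by eventually_elim (simp add: pole_counting_nonneg)
    show "\<forall>\<^sub>F r in at_top. pole_counting r g / T r \<le> (\<Sum>\<alpha>\<in>dom P. pole_counting r (a \<alpha>) / T r)"
      using T_pos
      by eventually_elim (use N_le in \<open>auto simp: sum_divide_distrib[symmetric] intro!: divide_right_mono\<close>)
  qed simp
  \<comment> \<open>The constant \<open>g 0\<close> from Jensen's formula is negligible because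
    \<open>T\<close> tends to infinity.\<close>
  moreover have "((\<lambda>r. g 0 / T r) \<longlongrightarrow> 0) at_top"
    by (rule real_tendsto_divide_at_top[OF tendsto_const T])
  ultimately have "((\<lambda>r. (pole_counting r g / T r - g 0 / T r) / d) \<longlongrightarrow> (0 - 0) / d) at_top"
    using d by (intro tendsto_intros) auto
  \<comment> \<open>By Jensen the null sequence is exactly the difference of the two quotients to be
    compared. Where \<open>T r = 0\<close>, both sides are 0 by the convention for division.\<close>
  moreover have "\<forall>\<^sub>F r in at_top. (pole_counting r g / T r - g 0 / T r) / d =
      pole_counting r (\<lambda>x. - g x) / (d * T r) - (1/2) * (g r + g (- r)) / (d * T r)"
    using eventually_gt_at_top[of "0::real"]
  proof eventually_elim
    case (elim r)
    have "(1/2) * (g r + g (- r)) = g 0 + pole_counting r (\<lambda>x. - g x) - pole_counting r g"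
      using tropical_jensen[OF g elim] by simp
    then show ?case by (simp add: diff_divide_distrib add_divide_distrib mult.commute)
  qed
  ultimately have "((\<lambda>r. pole_counting r (\<lambda>x. - g x) / (d * T r) -
      (1/2) * (g r + g (- r)) / (d * T r)) \<longlongrightarrow> 0) at_top"
    by (simp add: Lim_transform_eventually)
  from Liminf_ereal_mono_asymp[OF this] Limsup_ereal_mono_asymp[OF this] show ?thesis
    unfolding lower_psi_def upper_psi_def g_def T_def by simp
qed

end
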